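(* Let $Q=(q_{ij})$ be a real symmetric $n\times n$ matrix with zero diagonal, $c\in\mathbb{R}^n$, $R_i=\{j:q_{ij}\neq0\}$, $R^-_i=\{j:q_{ij}<0\}$, and let $\alpha_{ij}>0$ for $j\in R^-_i$ and $\beta_{ij}>0$ for $j\in R_i$, $i=1,\dots,n$. Consider the MILP ORPK($\alpha,\beta$) in variables $x_i$ and $y_{ij}$ ($j\in R_i$): maximize $\sum_{i=1}^n\sum_{j\in R_i}q_{ij}y_{ij}+\sum_{i=1}^n c_ix_i$ subject to $\sum_{j\in R^-_i}\alpha_{ij}(x_j-y_{ij})\le\left(\sum_{j\in R^-_i}\alpha_{ij}\right)(1-x_i)$ for $i=1,\dots,n$; $\sum_{j\in R_i}\beta_{ij}(y_{ij}+y_{ji})\le 2\left(\sum_{j\in R_i}\beta_{ij}\right)x_i$ for $i=1,\dots,n$; $x_i\in\{0,1\}$ for all $i$; $0\le y_{ij}\le 1$ for all $j\in R_i$, $i=1,\dots,n$. Then ORPK($\alpha,\beta$) is a valid formulation of QUBO.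
   Context: QUBO is the problem: maximize $\sum_{i=1}^n\sum_{j\in R_i}q_{ij}x_ix_j+\sum_{i=1}^n c_ix_i$ over $x\in\{0,1\}^n$. An MILP in variables $(x,y)$ with objective $\sum_i\sum_{j\in R_i}q_{ij}y_{ij}+\sum_i c_ix_i$ is a valid formulation of QUBO if its optimal objective value equals the optimal value of QUBO and the $x$-part of every optimal solution of the MILP is an optimal solution of QUBO (the variables $y_{ij}$ need only equal $x_ix_j$ at optimal solutions). *)

theory Defs
  imports "HOL-Analysis.Finite_Cartesian_Product" "HOL-Analysis.Cartesian_Space"
begin

(* An optimization problem is a pair (feasible set S, objective f), to be maximized. *)

definition optimal_solution :: "'a set \<Rightarrow> ('a \<Rightarrow> real) \<Rightarrow> 'a \<Rightarrow> bool" where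
  "optimal_solution S f s \<longleftrightarrow> is_arg_max f (\<lambda>t. t \<in> S) s"

(* A relation rather than a supremum, so that having an optimal value
   includes that the maximum is attained. *)
definition has_optimal_value :: "'a set \<Rightarrow> ('a \<Rightarrow> real) \<Rightarrow> real \<Rightarrow> bool" where
  "has_optimal_value S f v \<longleftrightarrow> (\<exists>s. optimal_solution S f s \<and> f s = v)"

definition R :: "real^'n^'n \<Rightarrow> 'n::finite \<Rightarrow> 'n set" where
  "R Q i = {j. Q $ i $ j \<noteq> 0}"

definition Rneg :: "real^'n^'n \<Rightarrow> 'n::finite \<Rightarrow> 'n set" where
  "Rneg Q i = {j. Q $ i $ j < 0}"

definition binary_vectors :: "(real^'n::finite) set" where
  "binary_vectors = {x. \<forall>i. x $ i \<in> {0, 1}}"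

definition qubo_objective :: "real^'n^'n \<Rightarrow> real^'n \<Rightarrow> real^'n::finite \<Rightarrow> real" where
  "qubo_objective Q c x =
     (\<Sum>i\<in>UNIV. \<Sum>j\<in>R Q i. Q $ i $ j * x $ i * x $ j) + (\<Sum>i\<in>UNIV. c $ i * x $ i)"

(* The variables y i j exist only for j in R Q i.  Here y is a total function, but its
   values at other index pairs occur in neither the objective nor the constraints. *)
definition milp_objective ::
    "real^'n^'n \<Rightarrow> real^'n \<Rightarrow> (real^'n::finite) \<times> ('n \<Rightarrow> 'n \<Rightarrow> real) \<Rightarrow> real" where
  "milp_objective Q c = (\<lambda>(x, y).
     (\<Sum>i\<in>UNIV. \<Sum>j\<in>R Q i. Q $ i $ j * y i j) + (\<Sum>i\<in>UNIV. c $ i * x $ i))"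

(* F is the feasible set of the MILP; its objective is always milp_objective. *)
definition valid_qubo_formulation ::
    "real^'n^'n \<Rightarrow> real^'n \<Rightarrow> ((real^'n::finite) \<times> ('n \<Rightarrow> 'n \<Rightarrow> real)) set \<Rightarrow> bool" where
  "valid_qubo_formulation Q c F \<longleftrightarrow>
     (\<exists>v. has_optimal_value F (milp_objective Q c) v \<and>
          has_optimal_value binary_vectors (qubo_objective Q c) v) \<and>
     (\<forall>x y. optimal_solution F (milp_objective Q c) (x, y) \<longrightarrow>
          optimal_solution binary_vectors (qubo_objective Q c) x)"

definition ORPK ::
    "real^'n^'n \<Rightarrow> ('n \<Rightarrow> 'n \<Rightarrow> real) \<Rightarrow> ('n \<Rightarrow> 'n \<Rightarrow> real) \<Rightarrow>
     ((real^'n::finite) \<times> ('n \<Rightarrow> 'n \<Rightarrow> real)) set" where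
  "ORPK Q \<alpha> \<beta> = {(x, y).
     (\<forall>i. (\<Sum>j\<in>Rneg Q i. \<alpha> i j * (x $ j - y i j)) \<le> (\<Sum>j\<in>Rneg Q i. \<alpha> i j) * (1 - x $ i)) \<and>
     (\<forall>i. (\<Sum>j\<in>R Q i. \<beta> i j * (y i j + y j i)) \<le> 2 * (\<Sum>j\<in>R Q i. \<beta> i j) * x $ i) \<and>
     (\<forall>i. x $ i \<in> {0, 1}) \<and>
     (\<forall>i. \<forall>j\<in>R Q i. 0 \<le> y i j \<and> y i j \<le> 1)}"

end

theory Submission imports Defs begin

text \<open>
  At a feasible point, \<open>x\<^sub>i = 0\<close> makes the right-hand side of the \<open>\<beta>\<close>-constraint of row \<open>i\<close>
  vanish, so every \<open>y\<close>-variable touching \<open>i\<close> is zero. If \<open>x\<^sub>i = 1\<close>, the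
  \<open>\<alpha>\<close>-constraint says that a sum of nonnegative terms \<open>\<alpha>\<^sub>i\<^sub>j (x\<^sub>j - y\<^sub>i\<^sub>j)\<close> is at most
  zero, so \<open>y\<^sub>i\<^sub>j = x\<^sub>j\<close> whenever \<open>q\<^sub>i\<^sub>j < 0\<close>. Hence
  \<open>q\<^sub>i\<^sub>j y\<^sub>i\<^sub>j \<le> q\<^sub>i\<^sub>j x\<^sub>i x\<^sub>j\<close> at every feasible point, and the products
  \<open>y\<^sub>i\<^sub>j = x\<^sub>i x\<^sub>j\<close> are feasible, so the MILP is an exact relaxation of QUBO for each fixed \<open>x\<close>.
\<close>

text \<open>Binary vectors are the indicator vectors of index sets, and there are only finitely many
  of these. This is what makes the QUBO maximum attained.\<close>

lemma finite_binary_vectors: "finite (binary_vectors :: (real^'n::finite) set)"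
proof (rule finite_subset)
  show "binary_vectors \<subseteq> range (\<lambda>A :: 'n set. \<chi> i. if i \<in> A then 1 else 0)"
  proof
    fix x :: "real^'n"
    assume "x \<in> binary_vectors"
    then have "x = (\<chi> i. if i \<in> {i. x $ i = 1} then 1 else 0)"
      by (auto simp: binary_vectors_def vec_eq_iff)
    then show "x \<in> range (\<lambda>A :: 'n set. \<chi> i. if i \<in> A then 1 else 0)"
      by blast
  qed
qed simp

lemma optimal_solution_iff:
  "optimal_solution S f s \<longleftrightarrow> s \<in> S \<and> (\<forall>t\<in>S. f t \<le> f s)"
  by (auto simp: optimal_solution_def is_arg_max_linorder)

lemma optimal_solution_exists:
  assumes "finite S" and "S \<noteq> {}"
  obtains s where "optimal_solution S f s"
proof -
  have "Max (f ` S) \<in> f ` S"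
    using assms by simp
  then obtain s where "s \<in> S" and "f s = Max (f ` S)"
    by auto
  with assms have "optimal_solution S f s"
    by (simp add: optimal_solution_iff)
  with that show thesis .
qed

text \<open>\<open>bound\<close> and \<open>lift\<close> together say that, for each binary
  \<open>x\<close>, the best MILP value over all feasible \<open>y\<close> is exactly
  \<open>qubo_objective Q c x\<close>, attained at \<open>Y x\<close>. Maximizing over
  \<open>F\<close> thus reduces to maximizing over \<open>x\<close>.\<close>

lemma valid_qubo_formulationI:
  fixes F :: "((real^'n::finite) \<times> ('n \<Rightarrow> 'n \<Rightarrow> real)) set"
  assumes binary: "\<And>x y. (x, y) \<in> F \<Longrightarrow> x \<in> binary_vectors"
    and bound: "\<And>x y. (x, y) \<in> F \<Longrightarrow> milp_objective Q c (x, y) \<le> qubo_objective Q c x"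
    and lift: "\<And>x. x \<in> binary_vectors \<Longrightarrow>
      (x, Y x) \<in> F \<and> milp_objective Q c (x, Y x) = qubo_objective Q c x"
  shows "valid_qubo_formulation Q c F"
proof -
  have "0 \<in> (binary_vectors :: (real^'n) set)"
    by (simp add: binary_vectors_def)
  then obtain x where x: "optimal_solution binary_vectors (qubo_objective Q c) x"
    using optimal_solution_exists[OF finite_binary_vectors] by blast
  have "optimal_solution F (milp_objective Q c) (x, Y x)"
    unfolding optimal_solution_iff
  proof (intro conjI ballI)
    from x show "(x, Y x) \<in> F"
      using lift by (simp add: optimal_solution_iff)
    fix t
    assume "t \<in> F"
    then obtain z y where t: "t = (z, y)" and zy: "(z, y) \<in> F"
      by (cases t) auto
    have "milp_objective Q c (z, y) \<le> qubo_objective Q c z"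
      using bound[OF zy] .
    also have "\<dots> \<le> qubo_objective Q c x"
      using x binary[OF zy] by (simp add: optimal_solution_iff)
    also have "\<dots> = milp_objective Q c (x, Y x)"
      using x lift by (simp add: optimal_solution_iff)
    finally show "milp_objective Q c t \<le> milp_objective Q c (x, Y x)"
      by (simp add: t)
  qed
  with x have "\<exists>v. has_optimal_value F (milp_objective Q c) v \<and>
      has_optimal_value binary_vectors (qubo_objective Q c) v"
    using lift[of x] by (metis has_optimal_value_def optimal_solution_iff)
  moreover have "optimal_solution binary_vectors (qubo_objective Q c) x"
    if "optimal_solution F (milp_objective Q c) (x, y)" for x y
    unfolding optimal_solution_iff
  proof (intro conjI ballI)
    have xy: "(x, y) \<in> F" and max: "\<And>t. t \<in> F \<Longrightarrow>
        milp_objective Q c t \<le> milp_objective Q c (x, y)"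
      using that by (auto simp: optimal_solution_iff)
    from binary[OF xy] show "x \<in> binary_vectors" .
    fix z :: "real^'n"
    assume "z \<in> binary_vectors"
    \<comment> \<open>The competitor \<open>z\<close> is lifted to \<open>(z, Y z)\<close> and
      compared with \<open>(x, y)\<close> inside \<open>F\<close>; \<open>bound\<close> then brings
      the comparison back to QUBO values.\<close>
    then show "qubo_objective Q c z \<le> qubo_objective Q c x"
      using lift[of z] max[of "(z, Y z)"] bound[OF xy] by simp
  qed
  ultimately show ?thesis
    by (simp add: valid_qubo_formulation_def)
qed

lemma sum_weighted_le_zero_imp:
  fixes w f :: "'a \<Rightarrow> real"
  assumes "finite A" and "\<And>j. j \<in> A \<Longrightarrow> 0 < w j" and "\<And>j. j \<in> A \<Longrightarrow> 0 \<le> f j"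
    and "(\<Sum>j\<in>A. w j * f j) \<le> 0" and "j \<in> A"
  shows "f j = 0"
proof -
  have nonneg: "\<And>j. j \<in> A \<Longrightarrow> 0 \<le> w j * f j"
    using assms(2,3) by (simp add: less_imp_le)
  then have "(\<Sum>j\<in>A. w j * f j) = 0"
    using assms(4) by (simp add: sum_nonneg order_antisym)
  then have "w j * f j = 0"
    using nonneg assms(1,5) by (simp add: sum_nonneg_eq_0_iff)
  with assms(2)[OF assms(5)] show ?thesis
    by simp
qed

text \<open>Needed because the bounds on \<open>y j i\<close> are imposed only for
  \<open>i \<in> R Q j\<close>, while the \<beta>-constraint of row \<open>i\<close> sums over
  \<open>j \<in> R Q i\<close>.\<close>

lemma R_sym:
  assumes "transpose Q = Q"
  shows "j \<in> R Q i \<longleftrightarrow> i \<in> R Q j"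
proof -
  have "transpose Q $ i $ j = Q $ j $ i"
    by (simp add: transpose_def)
  with assms show ?thesis
    by (simp add: R_def)
qed

lemma ORPK_y_eq_0:
  assumes sym: "transpose Q = Q"
    and \<beta>: "\<forall>i. \<forall>j\<in>R Q i. \<beta> i j > 0"
    and xy: "(x, y) \<in> ORPK Q \<alpha> \<beta>"
    and j: "j \<in> R Q i" and "x $ i = 0"
  shows "y i j = 0" and "y j i = 0"
proof -
  have nonneg: "0 \<le> y i j" "0 \<le> y j i" if "j \<in> R Q i" for j
    using xy that R_sym[OF sym] by (auto simp: ORPK_def)
  have "(\<Sum>j\<in>R Q i. \<beta> i j * (y i j + y j i)) \<le> 2 * (\<Sum>j\<in>R Q i. \<beta> i j) * x $ i"
    using xy by (simp add: ORPK_def)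
  then have "(\<Sum>j\<in>R Q i. \<beta> i j * (y i j + y j i)) \<le> 0"
    using \<open>x $ i = 0\<close> by simp
  then have "y i j + y j i = 0"
    by (rule sum_weighted_le_zero_imp[rotated 3]) (use \<beta> j nonneg in auto)
  then show "y i j = 0" and "y j i = 0"
    using nonneg[OF j] by auto
qed

lemma ORPK_y_eq_1:
  assumes sym: "transpose Q = Q"
    and \<alpha>: "\<forall>i. \<forall>j\<in>Rneg Q i. \<alpha> i j > 0"
    and \<beta>: "\<forall>i. \<forall>j\<in>R Q i. \<beta> i j > 0"
    and xy: "(x, y) \<in> ORPK Q \<alpha> \<beta>"
    and j: "j \<in> Rneg Q i" and "x $ i = 1" and "x $ j = 1"
  shows "y i j = 1"
proof -
  \<comment> \<open>If \<open>x $ k = 1\<close>, this is the bound \<open>y i k \<le> 1\<close>; if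
    \<open>x $ k = 0\<close>, the \<beta>-constraint of row \<open>k\<close> forces
    \<open>y i k = 0\<close>.\<close>
  have nonneg: "0 \<le> x $ k - y i k" if "k \<in> Rneg Q i" for k
  proof -
    have k: "k \<in> R Q i"
      using that by (simp add: R_def Rneg_def)
    have "x $ k = 0 \<or> x $ k = 1" and "y i k \<le> 1"
      using xy k by (auto simp: ORPK_def)
    then show ?thesis
      using ORPK_y_eq_0(2)[OF sym \<beta> xy] k R_sym[OF sym] by fastforce
  qed
  have "(\<Sum>j\<in>Rneg Q i. \<alpha> i j * (x $ j - y i j)) \<le> (\<Sum>j\<in>Rneg Q i. \<alpha> i j) * (1 - x $ i)"
    using xy by (simp add: ORPK_def)
  then have "(\<Sum>j\<in>Rneg Q i. \<alpha> i j * (x $ j - y i j)) \<le> 0"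
    using \<open>x $ i = 1\<close> by simp
  then have "x $ j - y i j = 0"
    by (rule sum_weighted_le_zero_imp[rotated 3]) (use \<alpha> j nonneg in auto)
  then show ?thesis
    using \<open>x $ j = 1\<close> by simp
qed

lemma ORPK_term_le:
  assumes sym: "transpose Q = Q"
    and \<alpha>: "\<forall>i. \<forall>j\<in>Rneg Q i. \<alpha> i j > 0"
    and \<beta>: "\<forall>i. \<forall>j\<in>R Q i. \<beta> i j > 0"
    and xy: "(x, y) \<in> ORPK Q \<alpha> \<beta>"
    and j: "j \<in> R Q i"
  shows "Q $ i $ j * y i j \<le> Q $ i $ j * x $ i * x $ j"
proof -
  have "x $ i \<in> {0, 1}" and "x $ j \<in> {0, 1}" and y: "y i j \<le> 1"
    using xy j by (auto simp: ORPK_def)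
  then consider "x $ i = 0" | "x $ j = 0" | "x $ i = 1" "x $ j = 1"
    by auto
  then show ?thesis
  proof cases
    case 1
    then show ?thesis
      using ORPK_y_eq_0(1)[OF sym \<beta> xy j] by simp
  next
    case 2
    \<comment> \<open>Here the \<beta>-constraint of row \<open>j\<close> is the one that applies,
      with the two indices exchanged.\<close>
    then show ?thesis
      using ORPK_y_eq_0(2)[OF sym \<beta> xy] j R_sym[OF sym] by fastforce
  next
    case 3
    show ?thesis
    proof (cases "Q $ i $ j < 0")
      case True
      then show ?thesis
        using ORPK_y_eq_1[OF sym \<alpha> \<beta> xy] 3 by (simp add: Rneg_def)
    next
      case False
      \<comment> \<open>With a nonnegative coefficient the objective pushes \<open>y i j\<close>
        upwards, so the bound \<open>y i j \<le> 1\<close> suffices.\<close>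
      then show ?thesis
        using 3 y by (simp add: mult_left_le)
    qed
  qed
qed

text \<open>Both aggregated constraints hold term by term:
  \<open>x $ j * (1 - x $ i) \<le> 1 - x $ i\<close> and
  \<open>2 * x $ i * x $ j \<le> 2 * x $ i\<close>, each scaled by a positive weight.\<close>

lemma ORPK_products:
  assumes \<alpha>: "\<forall>i. \<forall>j\<in>Rneg Q i. \<alpha> i j > 0"
    and \<beta>: "\<forall>i. \<forall>j\<in>R Q i. \<beta> i j > 0"
    and "x \<in> binary_vectors"
  shows "(x, \<lambda>i j. x $ i * x $ j) \<in> ORPK Q \<alpha> \<beta>"
proof -
  have x: "x $ i = 0 \<or> x $ i = 1" for i
    using assms(3) by (auto simp: binary_vectors_def)
  then have range: "0 \<le> x $ i" "x $ i \<le> 1" for i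
    by (use x[of i] in auto)
  have "(\<Sum>j\<in>Rneg Q i. \<alpha> i j * (x $ j - x $ i * x $ j))
      \<le> (\<Sum>j\<in>Rneg Q i. \<alpha> i j) * (1 - x $ i)" for i
    unfolding sum_distrib_right
  proof (rule sum_mono)
    fix j assume "j \<in> Rneg Q i"
    then have "0 \<le> \<alpha> i j"
      using \<alpha> by (simp add: less_imp_le)
    then show "\<alpha> i j * (x $ j - x $ i * x $ j) \<le> \<alpha> i j * (1 - x $ i)"
      by (rule mult_left_mono[rotated]) (use x[of i] range(2)[of j] in auto)
  qed
  moreover have "(\<Sum>j\<in>R Q i. \<beta> i j * (x $ i * x $ j + x $ j * x $ i))
      \<le> 2 * (\<Sum>j\<in>R Q i. \<beta> i j) * x $ i" for i
    unfolding sum_distrib_right sum_distrib_left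
  proof (rule sum_mono)
    fix j assume "j \<in> R Q i"
    then have "0 \<le> \<beta> i j"
      using \<beta> by (simp add: less_imp_le)
    then have "\<beta> i j * (x $ i * x $ j + x $ j * x $ i) \<le> \<beta> i j * (2 * x $ i)"
      by (rule mult_left_mono[rotated]) (use x[of i] range(2)[of j] in auto)
    then show "\<beta> i j * (x $ i * x $ j + x $ j * x $ i) \<le> 2 * \<beta> i j * x $ i"
      by (simp add: ac_simps)
  qed
  ultimately show ?thesis
    using x range by (simp add: ORPK_def mult_le_one)
qed

theorem theorem18:
  fixes Q :: "real^'n^'n::finite"
    and c :: "real^'n"
    and \<alpha> \<beta> :: "'n \<Rightarrow> 'n \<Rightarrow> real"
  assumes "transpose Q = Q"
    and "\<forall>i. Q $ i $ i = 0"
    and "\<forall>i. \<forall>j\<in>Rneg Q i. \<alpha> i j > 0"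
    and "\<forall>i. \<forall>j\<in>R Q i. \<beta> i j > 0"
  shows "valid_qubo_formulation Q c (ORPK Q \<alpha> \<beta>)"
proof (rule valid_qubo_formulationI)
  fix x y
  assume xy: "(x, y) \<in> ORPK Q \<alpha> \<beta>"
  then show "x \<in> binary_vectors"
    by (simp add: ORPK_def binary_vectors_def)
  show "milp_objective Q c (x, y) \<le> qubo_objective Q c x"
    using ORPK_term_le[OF assms(1,3,4) xy]
    by (simp add: milp_objective_def qubo_objective_def sum_mono)
next
  fix x :: "real^'n"
  assume "x \<in> binary_vectors"
  \<comment> \<open>The lift \<open>Y x\<close> is chosen as the table of products, which turns the
    linear objective into the quadratic one.\<close>
  then show "(x, \<lambda>i j. x $ i * x $ j) \<in> ORPK Q \<alpha> \<beta> \<and>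
      milp_objective Q c (x, \<lambda>i j. x $ i * x $ j) = qubo_objective Q c x"
    using ORPK_products[OF assms(3,4)]
    by (simp add: milp_objective_def qubo_objective_def mult.assoc)
qed

end
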